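(* For every integer $m\ge 3$, the graph $X_{2^m,1}$ admits both an Abelian and a non-Abelian realization. In particular, for $\theta$ a nontrivial automorphism of order $2$ of $\mathbb Z_2^{\,m-1}$ and $G_{m,\theta}=\mathbb Z_2^{\,m-1}\rtimes_\theta\mathbb Z_4$, $$D^*\left(\mathbb Z_4\times\mathbb Z_2^{\,m-1}\right)\cong D^*(G_{m,\theta})\cong X_{2^m,\,1}.$$
   Context: All graphs are finite, simple and undirected. In a group, $e$ is the identity and $o(x)$ the order of $x$. For a finite group $G$, the Proper POE Complement Graph $D^*(G)$ has vertex set $G^*=G\setminus\{e\}$, and two distinct vertices $x,y$ are adjacent if and only if $o(xy)$ is not a prime number. A realization of a graph $\mathcal G$ is a finite group $G$ with $D^*(G)\cong\mathcal G$; it is an Abelian (resp. non-Abelian) realization if $G$ is Abelian (resp. non-Abelian). In $G_{m,\theta}=\mathbb Z_2^{\,m-1}\rtimes_\theta\mathbb Z_4$ a generator $g$ of $\mathbb Z_4$ acts on $\mathbb Z_2^{\,m-1}$ as the automorphism $\theta$ (so $g^k$ acts as $\theta^k$). For an even integer $h\ge 2$ and an integer $r\ge 1$, the graph $X_{h,r}$ is the join $$X_{h,r}=\overline{K}_{h-1}\vee\left(\bigvee_{i=1}^{r}\left(\tfrac h2\right)K_2\right),$$ where $\overline{K}_{h-1}$ is the edgeless graph on $h-1$ vertices, $\left(\frac h2\right)K_2$ is the disjoint union of $\frac h2$ copies of $K_2$, and the join $\vee$ of pairwise vertex-disjoint graphs is obtained from their disjoint union by adding all edges between vertices of different constituents.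 *)

theory Defs
  imports
    "HOL-Algebra.Multiplicative_Group"
    "HOL-Algebra.Product_Groups"
    "HOL-Algebra.Bij"
    "HOL-Algebra.Weak_Morphisms"
    "HOL-Computational_Algebra.Primes"
begin

section \<open>Simple graphs\<close>

text \<open>A graph is a vertex set together with a set of two-element edges \<open>{x, y}\<close>.\<close>

record 'a ugraph =
  uverts :: "'a set"
  uedges :: "'a set set"

definition finite_simple_graph :: "'a ugraph \<Rightarrow> bool" where
  "finite_simple_graph \<Gamma> \<longleftrightarrow>
     finite (uverts \<Gamma>) \<and>
     (\<forall>e\<in>uedges \<Gamma>. \<exists>x\<in>uverts \<Gamma>. \<exists>y\<in>uverts \<Gamma>. x \<noteq> y \<and> e = {x, y})"

definition ugraph_iso :: "'a ugraph \<Rightarrow> 'b ugraph \<Rightarrow> bool" where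
  "ugraph_iso \<Gamma> \<Delta> \<longleftrightarrow>
     (\<exists>f. bij_betw f (uverts \<Gamma>) (uverts \<Delta>) \<and>
          (\<forall>x\<in>uverts \<Gamma>. \<forall>y\<in>uverts \<Gamma>. {x, y} \<in> uedges \<Gamma> \<longleftrightarrow> {f x, f y} \<in> uedges \<Delta>))"

definition edgeless_graph :: "'a set \<Rightarrow> 'a ugraph" where
  "edgeless_graph V = \<lparr>uverts = V, uedges = {}\<rparr>"

definition complete_graph :: "'a set \<Rightarrow> 'a ugraph" where
  "complete_graph V = \<lparr>uverts = V, uedges = {{x, y} |x y. x \<in> V \<and> y \<in> V \<and> x \<noteq> y}\<rparr>"

text \<open>Disjointness of the constituents is ensured by tagging the vertices, with the index
  for families and with \<open>Inl\<close>/\<open>Inr\<close> for the join of two graphs.\<close>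

definition graph_disjoint_union :: "'i set \<Rightarrow> ('i \<Rightarrow> 'a ugraph) \<Rightarrow> ('i \<times> 'a) ugraph" where
  "graph_disjoint_union I \<Gamma> =
     \<lparr>uverts = (SIGMA i:I. uverts (\<Gamma> i)),
      uedges = (\<Union>i\<in>I. (\<lambda>e. Pair i ` e) ` uedges (\<Gamma> i))\<rparr>"

definition graph_join_family :: "'i set \<Rightarrow> ('i \<Rightarrow> 'a ugraph) \<Rightarrow> ('i \<times> 'a) ugraph" where
  "graph_join_family I \<Gamma> =
     \<lparr>uverts = uverts (graph_disjoint_union I \<Gamma>),
      uedges = uedges (graph_disjoint_union I \<Gamma>) \<union>
        {{(i, x), (j, y)} |i j x y.
           i \<in> I \<and> j \<in> I \<and> i \<noteq> j \<and> x \<in> uverts (\<Gamma> i) \<and> y \<in> uverts (\<Gamma> j)}\<rparr>"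

definition graph_join :: "'a ugraph \<Rightarrow> 'b ugraph \<Rightarrow> ('a + 'b) ugraph" where
  "graph_join \<Gamma> \<Delta> =
     \<lparr>uverts = Sum_Type.Plus (uverts \<Gamma>) (uverts \<Delta>),
      uedges = (\<lambda>e. Inl ` e) ` uedges \<Gamma> \<union> (\<lambda>e. Inr ` e) ` uedges \<Delta> \<union>
        {{Inl x, Inr y} |x y. x \<in> uverts \<Gamma> \<and> y \<in> uverts \<Delta>}\<rparr>"

definition graph_copies :: "nat \<Rightarrow> 'a ugraph \<Rightarrow> (nat \<times> 'a) ugraph" where
  "graph_copies n \<Gamma> = graph_disjoint_union {1..n} (\<lambda>_. \<Gamma>)"

text \<open>Meant for even \<open>h \<ge> 2\<close> and \<open>r \<ge> 1\<close>.\<close>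

definition X_graph :: "nat \<Rightarrow> nat \<Rightarrow> (nat + nat \<times> nat \<times> nat) ugraph" where
  "X_graph h r =
     graph_join (edgeless_graph {1..h - 1})
          (graph_join_family {1..r} (\<lambda>_. graph_copies (h div 2) (complete_graph {1..2})))"


section \<open>The proper POE complement graph and realizations\<close>

text \<open>\<open>HOL-Algebra\<close> has its own constant \<open>prime\<close> (for elements of a monoid), hence the
  qualified name.\<close>

definition POE_compl_graph :: "('a, 'b) monoid_scheme \<Rightarrow> 'a ugraph" where
  "POE_compl_graph G =
     \<lparr>uverts = carrier G - {\<one>\<^bsub>G\<^esub>},
      uedges = {{x, y} |x y.
        x \<in> carrier G - {\<one>\<^bsub>G\<^esub>} \<and> y \<in> carrier G - {\<one>\<^bsub>G\<^esub>} \<and> x \<noteq> y \<and>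
        \<not> Factorial_Ring.prime (group.ord G (x \<otimes>\<^bsub>G\<^esub> y))}\<rparr>"

definition realization :: "('a, 'b) monoid_scheme \<Rightarrow> 'c ugraph \<Rightarrow> bool" where
  "realization G \<Gamma> \<longleftrightarrow> group G \<and> finite (carrier G) \<and> ugraph_iso (POE_compl_graph G) \<Gamma>"

definition abelian_realization :: "('a, 'b) monoid_scheme \<Rightarrow> 'c ugraph \<Rightarrow> bool" where
  "abelian_realization G \<Gamma> \<longleftrightarrow> realization G \<Gamma> \<and> comm_group G"

definition nonabelian_realization :: "('a, 'b) monoid_scheme \<Rightarrow> 'c ugraph \<Rightarrow> bool" where
  "nonabelian_realization G \<Gamma> \<longleftrightarrow> realization G \<Gamma> \<and> \<not> comm_group G"

text \<open>Every finite group is isomorphic to one whose carrier is a set of natural numbers, so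
  existence of a realization is expressed over \<^typ>\<open>nat monoid\<close>.\<close>

definition admits_abelian_realization :: "'c ugraph \<Rightarrow> bool" where
  "admits_abelian_realization \<Gamma> \<longleftrightarrow> (\<exists>G :: nat monoid. abelian_realization G \<Gamma>)"

definition admits_nonabelian_realization :: "'c ugraph \<Rightarrow> bool" where
  "admits_nonabelian_realization \<Gamma> \<longleftrightarrow> (\<exists>G :: nat monoid. nonabelian_realization G \<Gamma>)"


section \<open>Semidirect products\<close>

definition semidirect_product ::
    "('a, 'c) monoid_scheme \<Rightarrow> ('b, 'd) monoid_scheme \<Rightarrow> ('b \<Rightarrow> 'a \<Rightarrow> 'a) \<Rightarrow> ('a \<times> 'b) monoid" where
  "semidirect_product N H \<phi> =
     \<lparr>carrier = carrier N \<times> carrier H,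
      monoid.mult = (\<lambda>(n, h) (n', h'). (n \<otimes>\<^bsub>N\<^esub> \<phi> h n', h \<otimes>\<^bsub>H\<^esub> h')),
      one = (\<one>\<^bsub>N\<^esub>, \<one>\<^bsub>H\<^esub>)\<rparr>"

definition Z2_pow :: "nat \<Rightarrow> (nat \<Rightarrow> int) monoid" where
  "Z2_pow n = product_group {1..n} (\<lambda>_. integer_mod_group 2)"

text \<open>The generator \<open>1\<close> of \<open>\<int>\<^sub>4\<close> acts as \<open>\<theta>\<close>. The result is meant for \<open>\<theta>\<close> with
  \<open>\<theta>\<^sup>4 = 1\<close> in the automorphism group, so that the action is a homomorphism.\<close>

definition G_semi :: "nat \<Rightarrow> ((nat \<Rightarrow> int) \<Rightarrow> nat \<Rightarrow> int) \<Rightarrow> ((nat \<Rightarrow> int) \<times> int) monoid" where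
  "G_semi m \<theta> =
     semidirect_product (Z2_pow (m - 1)) (integer_mod_group 4)
       (\<lambda>k. \<theta> [^]\<^bsub>AutoGroup (Z2_pow (m - 1))\<^esub> k)"

lemma finite_simple_graph_disjoint_union:
  assumes "finite I" "\<And>i. i \<in> I \<Longrightarrow> finite_simple_graph (\<Gamma> i)"
  shows "finite_simple_graph (graph_disjoint_union I \<Gamma>)"
  unfolding finite_simple_graph_def
proof (intro conjI ballI)
  show "finite (uverts (graph_disjoint_union I \<Gamma>))"
    using assms by (simp add: graph_disjoint_union_def finite_simple_graph_def)
next
  fix e assume "e \<in> uedges (graph_disjoint_union I \<Gamma>)"
  then obtain i d where "i \<in> I" "d \<in> uedges (\<Gamma> i)" and e: "e = Pair i ` d"
    by (auto simp: graph_disjoint_union_def)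
  moreover from this obtain x y where "x \<in> uverts (\<Gamma> i)" "y \<in> uverts (\<Gamma> i)" "x \<noteq> y" "d = {x, y}"
    using assms(2) unfolding finite_simple_graph_def by metis
  ultimately show "\<exists>x\<in>uverts (graph_disjoint_union I \<Gamma>).
      \<exists>y\<in>uverts (graph_disjoint_union I \<Gamma>). x \<noteq> y \<and> e = {x, y}"
    by (intro bexI[of _ "(i, x)"] bexI[of _ "(i, y)"]) (auto simp: graph_disjoint_union_def)
qed

lemma finite_simple_graph_join_family:
  assumes "finite I" "\<And>i. i \<in> I \<Longrightarrow> finite_simple_graph (\<Gamma> i)"
  shows "finite_simple_graph (graph_join_family I \<Gamma>)"
proof -
  have "finite_simple_graph (graph_disjoint_union I \<Gamma>)"
    using assms by (rule finite_simple_graph_disjoint_union)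
  then show ?thesis
    unfolding finite_simple_graph_def
  proof (intro conjI ballI, goal_cases)
    case 1
    then show ?case by (simp add: graph_join_family_def)
  next
    case (2 e)
    from 2(2) consider "e \<in> uedges (graph_disjoint_union I \<Gamma>)"
      | i j x y where "i \<in> I" "j \<in> I" "i \<noteq> j" "x \<in> uverts (\<Gamma> i)" "y \<in> uverts (\<Gamma> j)"
          "e = {(i, x), (j, y)}"
      unfolding graph_join_family_def ugraph.simps by blast
    then show ?case
    proof cases
      case 1
      then show ?thesis using 2(1) by (simp add: graph_join_family_def)
    next
      case (2 i j x y)
      then show ?thesis
        by (intro bexI[of _ "(i, x)"] bexI[of _ "(j, y)"])
          (auto simp: graph_join_family_def graph_disjoint_union_def)
    qed
  qed
qed

lemma finite_simple_graph_join:
  assumes "finite_simple_graph \<Gamma>" "finite_simple_graph \<Delta>"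
  shows "finite_simple_graph (graph_join \<Gamma> \<Delta>)"
  unfolding finite_simple_graph_def
proof (intro conjI ballI)
  show "finite (uverts (graph_join \<Gamma> \<Delta>))"
    using assms by (simp add: graph_join_def finite_simple_graph_def)
next
  fix e assume "e \<in> uedges (graph_join \<Gamma> \<Delta>)"
  then consider d where "d \<in> uedges \<Gamma>" "e = Inl ` d" | d where "d \<in> uedges \<Delta>" "e = Inr ` d"
    | x y where "x \<in> uverts \<Gamma>" "y \<in> uverts \<Delta>" "e = {Inl x, Inr y}"
    unfolding graph_join_def by auto
  then show "\<exists>x\<in>uverts (graph_join \<Gamma> \<Delta>). \<exists>y\<in>uverts (graph_join \<Gamma> \<Delta>). x \<noteq> y \<and> e = {x, y}"
  proof cases
    case 1
    then obtain x y where "x \<in> uverts \<Gamma>" "y \<in> uverts \<Gamma>" "x \<noteq> y" "d = {x, y}"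
      using assms(1) unfolding finite_simple_graph_def by metis
    then show ?thesis
      using 1 by (intro bexI[of _ "Inl x"] bexI[of _ "Inl y"]) (auto simp: graph_join_def)
  next
    case 2
    then obtain x y where "x \<in> uverts \<Delta>" "y \<in> uverts \<Delta>" "x \<noteq> y" "d = {x, y}"
      using assms(2) unfolding finite_simple_graph_def by metis
    then show ?thesis
      using 2 by (intro bexI[of _ "Inr x"] bexI[of _ "Inr y"]) (auto simp: graph_join_def)
  next
    case 3
    then show ?thesis
      by (intro bexI[of _ "Inl x"] bexI[of _ "Inr y"]) (auto simp: graph_join_def)
  qed
qed

lemma finite_simple_graph_X_graph: "finite_simple_graph (X_graph h r)"
proof -
  have "finite_simple_graph (edgeless_graph {1..h - 1})"
    by (simp add: finite_simple_graph_def edgeless_graph_def)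
  moreover have "finite_simple_graph (complete_graph {1..2 :: nat})"
    unfolding finite_simple_graph_def complete_graph_def
    by (simp only: ugraph.simps mem_Collect_eq finite_atLeastAtMost) blast
  ultimately show ?thesis
    unfolding X_graph_def graph_copies_def
    by (intro finite_simple_graph_join finite_simple_graph_join_family
        finite_simple_graph_disjoint_union) auto
qed

lemma finite_simple_graph_POE_compl_graph:
  "finite (carrier G) \<Longrightarrow> finite_simple_graph (POE_compl_graph G)"
  by (auto simp: finite_simple_graph_def POE_compl_graph_def)

lemma (in group) ord_mult_commute:
  assumes "x \<in> carrier G" "y \<in> carrier G"
  shows "ord (x \<otimes> y) = ord (y \<otimes> x)"
proof -
  have conj_pow: "(x \<otimes> y) [^] n \<otimes> x = x \<otimes> (y \<otimes> x) [^] n"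
    if "x \<in> carrier G" "y \<in> carrier G" for x y and n :: nat
  proof (induction n)
    case 0
    show ?case using that by simp
  next
    case (Suc n)
    have "(x \<otimes> y) [^] Suc n \<otimes> x = ((x \<otimes> y) [^] n \<otimes> x) \<otimes> (y \<otimes> x)"
      using that by (simp add: m_assoc)
    also have "\<dots> = x \<otimes> (y \<otimes> x) [^] Suc n"
      using that by (simp add: Suc m_assoc)
    finally show ?case .
  qed
  have imp: "(y \<otimes> x) [^] n = \<one>"
    if "x \<in> carrier G" "y \<in> carrier G" "(x \<otimes> y) [^] n = \<one>" for x y and n :: nat
    using conj_pow[OF that(1,2), of n] that by simp
  have "(x \<otimes> y) [^] n = \<one> \<longleftrightarrow> (y \<otimes> x) [^] n = \<one>" for n :: nat
    using imp assms by blast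
  then show ?thesis
    by (simp add: ord_def)
qed

lemma (in group) POE_compl_graph_edge_iff:
  assumes "x \<in> carrier G - {\<one>}" "y \<in> carrier G - {\<one>}"
  shows "{x, y} \<in> uedges (POE_compl_graph G) \<longleftrightarrow>
    x \<noteq> y \<and> \<not> Factorial_Ring.prime (ord (x \<otimes> y))"
  using assms ord_mult_commute[of x y] by (auto simp: POE_compl_graph_def doubleton_eq_iff)

lemma ugraph_iso_POE_compl_graph:
  assumes "group G" "group H" "f \<in> iso G H"
  shows "ugraph_iso (POE_compl_graph H) (POE_compl_graph G)"
proof -
  let ?g = "inv_into (carrier G) f"
  interpret G: group G by fact
  interpret H: group H by fact
  have "?g \<in> iso H G" by (rule G.iso_set_sym[OF assms(3)])
  then have hom: "?g \<in> hom H G" and bij: "bij_betw ?g (carrier H) (carrier G)"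
    by (auto simp: iso_def)
  have one: "?g \<one>\<^bsub>H\<^esub> = \<one>\<^bsub>G\<^esub>"
    by (rule hom_one[OF hom assms(2,1)])
  have closed: "?g x \<in> carrier G" if "x \<in> carrier H" for x
    using hom that by (auto simp: hom_def)
  have eq_iff: "?g x = ?g y \<longleftrightarrow> x = y" if "x \<in> carrier H" "y \<in> carrier H" for x y
    using bij that by (auto simp: bij_betw_def inj_on_def)
  have ord: "G.ord (?g x) = H.ord x" if "x \<in> carrier H" for x
  proof -
    have "?g x [^]\<^bsub>G\<^esub> n = \<one>\<^bsub>G\<^esub> \<longleftrightarrow> x [^]\<^bsub>H\<^esub> n = \<one>\<^bsub>H\<^esub>" for n :: nat
      using eq_iff[of "x [^]\<^bsub>H\<^esub> n" "\<one>\<^bsub>H\<^esub>"] hom_nat_pow[OF hom that assms(2,1), of n] that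
      by (simp add: one)
    then show ?thesis by (simp add: G.ord_def H.ord_def)
  qed
  have mem: "?g x \<in> carrier G - {\<one>\<^bsub>G\<^esub>}" if "x \<in> carrier H - {\<one>\<^bsub>H\<^esub>}" for x
    using that closed eq_iff[of x "\<one>\<^bsub>H\<^esub>"] one by auto
  have "bij_betw ?g (carrier H - {\<one>\<^bsub>H\<^esub>}) (carrier G - {\<one>\<^bsub>G\<^esub>})"
    using bij_betw_DiffI[OF bij, of "{\<one>\<^bsub>H\<^esub>}" "{\<one>\<^bsub>G\<^esub>}"] one by (simp add: bij_betw_def)
  moreover have "{x, y} \<in> uedges (POE_compl_graph H) \<longleftrightarrow> {?g x, ?g y} \<in> uedges (POE_compl_graph G)"
    if xy: "x \<in> carrier H - {\<one>\<^bsub>H\<^esub>}" "y \<in> carrier H - {\<one>\<^bsub>H\<^esub>}" for x y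
  proof -
    have "?g x \<otimes>\<^bsub>G\<^esub> ?g y = ?g (x \<otimes>\<^bsub>H\<^esub> y)"
      using hom xy by (simp add: hom_mult)
    then show ?thesis
      unfolding H.POE_compl_graph_edge_iff[OF xy] G.POE_compl_graph_edge_iff[OF xy[THEN mem]]
      using xy eq_iff[of x y] ord[of "x \<otimes>\<^bsub>H\<^esub> y"] by simp
  qed
  ultimately show ?thesis
    unfolding ugraph_iso_def by (auto simp: POE_compl_graph_def)
qed

lemma ugraph_iso_trans:
  assumes "ugraph_iso \<Gamma> \<Delta>" "ugraph_iso \<Delta> \<Theta>"
  shows "ugraph_iso \<Gamma> \<Theta>"
proof -
  obtain f where f: "bij_betw f (uverts \<Gamma>) (uverts \<Delta>)"
      "\<And>x y. x \<in> uverts \<Gamma> \<Longrightarrow> y \<in> uverts \<Gamma> \<Longrightarrow> {x, y} \<in> uedges \<Gamma> \<longleftrightarrow> {f x, f y} \<in> uedges \<Delta>"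
    using assms(1) unfolding ugraph_iso_def by blast
  obtain g where g: "bij_betw g (uverts \<Delta>) (uverts \<Theta>)"
      "\<And>x y. x \<in> uverts \<Delta> \<Longrightarrow> y \<in> uverts \<Delta> \<Longrightarrow> {x, y} \<in> uedges \<Delta> \<longleftrightarrow> {g x, g y} \<in> uedges \<Theta>"
    using assms(2) unfolding ugraph_iso_def by blast
  show ?thesis
    unfolding ugraph_iso_def
    using bij_betw_trans[OF f(1) g(1)] f(2) g(2) bij_betwE[OF f(1)]
    by (intro exI[of _ "g \<circ> f"]) simp
qed

lemma realization_over_nat:
  assumes "realization G \<Gamma>"
  shows "\<exists>H :: nat monoid. realization H \<Gamma> \<and> (comm_group H \<longleftrightarrow> comm_group G)"
proof -
  interpret group G using assms by (simp add: realization_def)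
  have fin: "finite (carrier G)" using assms by (simp add: realization_def)
  then obtain f :: "'a \<Rightarrow> nat" where f: "inj_on f (carrier G)"
    using finite_imp_inj_to_nat_seg by metis
  let ?H = "image_group f G"
  have H: "group ?H" by (rule inj_imp_image_group_is_group[OF f])
  have iso: "f \<in> iso G ?H" by (rule inj_imp_image_group_iso[OF f])
  have "ugraph_iso (POE_compl_graph ?H) \<Gamma>"
    using ugraph_iso_POE_compl_graph[OF is_group H iso] assms
    by (auto simp: realization_def intro: ugraph_iso_trans)
  then have "realization ?H \<Gamma>"
    using H fin by (simp add: realization_def image_group_def)
  moreover have "G \<cong> ?H" "?H \<cong> G"
    using iso iso_set_sym[OF iso] by (auto simp: is_iso_def)
  then have "comm_group ?H \<longleftrightarrow> comm_group G"
    using H is_monoid by (auto dest: comm_group.iso_imp_comm_group group.is_monoid)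
  ultimately show ?thesis by blast
qed

lemma admits_abelian_realizationI:
  "abelian_realization G \<Gamma> \<Longrightarrow> admits_abelian_realization \<Gamma>"
  using realization_over_nat[of G \<Gamma>]
  by (auto simp: abelian_realization_def admits_abelian_realization_def)

lemma admits_nonabelian_realizationI:
  "nonabelian_realization G \<Gamma> \<Longrightarrow> admits_nonabelian_realization \<Gamma>"
  using realization_over_nat[of G \<Gamma>]
  by (auto simp: nonabelian_realization_def admits_nonabelian_realization_def)

lemma group_semidirect_product:
  assumes "group N" "group H" "\<phi> \<in> hom H (AutoGroup N)"
  shows "group (semidirect_product N H \<phi>)"
proof -
  interpret N: group N by fact
  interpret H: group H by fact
  have aut: "\<phi> h \<in> hom N N" "\<phi> h \<in> Bij (carrier N)" if "h \<in> carrier H" for h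
    using assms(3) that by (auto simp: hom_def AutoGroup_def auto_def)
  have closed: "\<phi> h n \<in> carrier N" if "h \<in> carrier H" "n \<in> carrier N" for h n
    using aut[OF that(1)] that(2) by (auto simp: hom_def)
  have mult: "\<phi> h (n \<otimes>\<^bsub>N\<^esub> n') = \<phi> h n \<otimes>\<^bsub>N\<^esub> \<phi> h n'"
    if "h \<in> carrier H" "n \<in> carrier N" "n' \<in> carrier N" for h n n'
    using aut[OF that(1)] that(2,3) by (auto simp: hom_def)
  have comp: "\<phi> (h \<otimes>\<^bsub>H\<^esub> h') n = \<phi> h (\<phi> h' n)"
    if "h \<in> carrier H" "h' \<in> carrier H" "n \<in> carrier N" for h h' n
    using hom_mult[OF assms(3) that(1,2)] aut[OF that(1)] aut[OF that(2)] that(3)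
    by (simp add: AutoGroup_def BijGroup_def compose_def)
  have one: "\<phi> \<one>\<^bsub>H\<^esub> n = n" if "n \<in> carrier N" for n
  proof -
    have "\<phi> \<one>\<^bsub>H\<^esub> = \<one>\<^bsub>AutoGroup N\<^esub>"
      using hom_one[OF assms(3) assms(2) N.AutoGroup] .
    then show ?thesis using that by (simp add: AutoGroup_def BijGroup_def)
  qed
  show ?thesis
  proof (rule groupI)
    fix p assume p: "p \<in> carrier (semidirect_product N H \<phi>)"
    then obtain n h where nh: "p = (n, h)" "n \<in> carrier N" "h \<in> carrier H"
      by (auto simp: semidirect_product_def)
    let ?q = "(\<phi> (inv\<^bsub>H\<^esub> h) (inv\<^bsub>N\<^esub> n), inv\<^bsub>H\<^esub> h)"
    have "?q \<in> carrier (semidirect_product N H \<phi>)"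
      using nh closed by (simp add: semidirect_product_def)
    moreover have "\<phi> k \<one>\<^bsub>N\<^esub> = \<one>\<^bsub>N\<^esub>" if "k \<in> carrier H" for k
      using hom_one[OF aut(1)[OF that]] assms(1) by blast
    then have "?q \<otimes>\<^bsub>semidirect_product N H \<phi>\<^esub> p = \<one>\<^bsub>semidirect_product N H \<phi>\<^esub>"
      using nh by (simp add: semidirect_product_def mult[symmetric])
    ultimately show "\<exists>q\<in>carrier (semidirect_product N H \<phi>).
        q \<otimes>\<^bsub>semidirect_product N H \<phi>\<^esub> p = \<one>\<^bsub>semidirect_product N H \<phi>\<^esub>"
      by blast
  qed (auto simp: semidirect_product_def closed mult comp one N.m_assoc H.m_assoc)
qed

lemma group_Z2_pow: "group (Z2_pow n)"
  by (simp add: Z2_pow_def)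

lemma group_G_semi:
  assumes "\<theta> \<in> carrier (AutoGroup (Z2_pow (m - 1)))"
    and "group.ord (AutoGroup (Z2_pow (m - 1))) \<theta> = 2"
  shows "group (G_semi m \<theta>)"
proof -
  let ?A = "AutoGroup (Z2_pow (m - 1))"
  interpret A: group ?A
    using group_Z2_pow by (rule group.AutoGroup)
  have "\<theta> [^]\<^bsub>?A\<^esub> ((j + k) mod 4) = \<theta> [^]\<^bsub>?A\<^esub> j \<otimes>\<^bsub>?A\<^esub> \<theta> [^]\<^bsub>?A\<^esub> k" for j k :: int
  proof -
    have "int (A.ord \<theta>) dvd (j + k) mod 4 - (j + k)"
      using assms(2) by simp presburger
    then show ?thesis
      using assms(1) by (metis A.int_pow_eq A.int_pow_mult)
  qed
  then have "(\<lambda>k::int. \<theta> [^]\<^bsub>?A\<^esub> k) \<in> hom (integer_mod_group 4) ?A"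
    using assms(1) A.int_pow_closed by (auto simp: hom_def simp del: One_nat_def)
  then show ?thesis
    unfolding G_semi_def
    by (intro group_semidirect_product group_Z2_pow group_integer_mod_group)
qed

end

(* Both groups have a subgroup H of index 2, given by an even Z4-component, such that every element
   of H squares to the identity and no element outside H does. Hence elements outside H have order 4,
   and the order of xy is prime iff xy is a nontrivial element of H. So the nontrivial elements of H
   are pairwise nonadjacent, every element of H is adjacent to every element outside H, and distinct
   elements outside H are adjacent iff they are mutually inverse; inversion is fixed-point free
   there, which gives the copies of K2. *)
theory Submission
  imports Defs "HOL-Combinatorics.Transposition"
begin

section \<open>Edges of the graph constructions and of \<open>X_graph\<close>\<close>

lemma ugraph_iso_sym:
  assumes "ugraph_iso \<Gamma> \<Delta>"
  shows "ugraph_iso \<Delta> \<Gamma>"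
proof -
  obtain f where f: "bij_betw f (uverts \<Gamma>) (uverts \<Delta>)"
      "\<And>x y. x \<in> uverts \<Gamma> \<Longrightarrow> y \<in> uverts \<Gamma> \<Longrightarrow> {x, y} \<in> uedges \<Gamma> \<longleftrightarrow> {f x, f y} \<in> uedges \<Delta>"
    using assms unfolding ugraph_iso_def by blast
  let ?g = "inv_into (uverts \<Gamma>) f"
  have g: "bij_betw ?g (uverts \<Delta>) (uverts \<Gamma>)"
    by (rule bij_betw_inv_into[OF f(1)])
  show ?thesis
    unfolding ugraph_iso_def
    using g f(2) bij_betwE[OF g] bij_betw_inv_into_right[OF f(1)]
    by (intro exI[of _ ?g]) simp
qed

text \<open>Edge sets of unions and joins are images under tagging maps. These are injective, so
  taking images of sets is injective too and the tag can be cancelled.\<close>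

lemma image_eq_doubleton_iff:
  assumes "inj f"
  shows "{f x, f y} \<in> (`) f ` E \<longleftrightarrow> {x, y} \<in> E"
proof -
  have "f ` {x, y} \<in> (`) f ` E \<longleftrightarrow> {x, y} \<in> E"
    unfolding image_iff inj_image_eq_iff[OF assms] by simp
  then show ?thesis by simp
qed

lemma complete_graph_edge_iff:
  "{x, y} \<in> uedges (complete_graph V) \<longleftrightarrow> x \<in> V \<and> y \<in> V \<and> x \<noteq> y"
  by (auto simp: complete_graph_def doubleton_eq_iff)

lemma graph_disjoint_union_edge_iff:
  "{(i, x), (j, y)} \<in> uedges (graph_disjoint_union I \<Gamma>) \<longleftrightarrow>
     i \<in> I \<and> i = j \<and> {x, y} \<in> uedges (\<Gamma> i)"
proof
  assume "{(i, x), (j, y)} \<in> uedges (graph_disjoint_union I \<Gamma>)"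
  then obtain k e where k: "k \<in> I" "e \<in> uedges (\<Gamma> k)" "{(i, x), (j, y)} = Pair k ` e"
    by (auto simp: graph_disjoint_union_def)
  then have "(i, x) \<in> Pair k ` e" "(j, y) \<in> Pair k ` e" by auto
  then have "i = k" "j = k" by auto
  moreover from this have "{x, y} \<in> uedges (\<Gamma> k)"
    using k image_eq_doubleton_iff[of "Pair k" x y "uedges (\<Gamma> k)"] by (simp add: inj_on_def)
  ultimately show "i \<in> I \<and> i = j \<and> {x, y} \<in> uedges (\<Gamma> i)" using k by simp
next
  assume "i \<in> I \<and> i = j \<and> {x, y} \<in> uedges (\<Gamma> i)"
  then show "{(i, x), (j, y)} \<in> uedges (graph_disjoint_union I \<Gamma>)"
    by (auto simp: graph_disjoint_union_def intro!: bexI[of _ i] image_eqI[of _ _ "{x, y}"])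
qed

text \<open>The added join edges have distinct indices, so inside one constituent only its own edges
  remain. This case suffices for r = 1, where the family has a single member.\<close>

lemma graph_join_family_edge_iff:
  "{(i, x), (i, y)} \<in> uedges (graph_join_family I \<Gamma>) \<longleftrightarrow> i \<in> I \<and> {x, y} \<in> uedges (\<Gamma> i)"
  using graph_disjoint_union_edge_iff[of i x i y I \<Gamma>]
  by (auto simp: graph_join_family_def doubleton_eq_iff)

text \<open>Serves, with its mirror image below, to discard edges carrying the wrong tag. The form
  with \<open>insert\<close> covers both {Inl x, Inl x'} and the mixed {Inl x, Inr y}.\<close>

lemma insert_Inl_neq_image_Inr: "insert (Inl u) S \<noteq> Inr ` A"
  by (auto simp: set_eq_iff)

lemma insert_Inr_neq_image_Inl: "insert (Inr u) S \<noteq> Inl ` A"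
  by (auto simp: set_eq_iff)

lemma graph_join_edge_iff:
  fixes \<Gamma> :: "'a ugraph" and \<Delta> :: "'b ugraph"
  shows "{Inl x, Inl x'} \<in> uedges (graph_join \<Gamma> \<Delta>) \<longleftrightarrow> {x, x'} \<in> uedges \<Gamma>"
  "{Inr y, Inr y'} \<in> uedges (graph_join \<Gamma> \<Delta>) \<longleftrightarrow> {y, y'} \<in> uedges \<Delta>"
  "{Inl x, Inr y} \<in> uedges (graph_join \<Gamma> \<Delta>) \<longleftrightarrow> x \<in> uverts \<Gamma> \<and> y \<in> uverts \<Delta>"
proof -
  have "{Inl x, Inl x'} \<in> uedges (graph_join \<Gamma> \<Delta>) \<longleftrightarrow> ({Inl x, Inl x'} :: ('a + 'b) set) \<in> (`) Inl ` uedges \<Gamma>"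
    by (simp add: insert_Inl_neq_image_Inr graph_join_def image_iff doubleton_eq_iff)
  then show "{Inl x, Inl x'} \<in> uedges (graph_join \<Gamma> \<Delta>) \<longleftrightarrow> {x, x'} \<in> uedges \<Gamma>"
    by (simp only: image_eq_doubleton_iff[OF inj_Inl])
  have "{Inr y, Inr y'} \<in> uedges (graph_join \<Gamma> \<Delta>) \<longleftrightarrow> ({Inr y, Inr y'} :: ('a + 'b) set) \<in> (`) Inr ` uedges \<Delta>"
    by (simp add: insert_Inr_neq_image_Inl graph_join_def image_iff doubleton_eq_iff)
  then show "{Inr y, Inr y'} \<in> uedges (graph_join \<Gamma> \<Delta>) \<longleftrightarrow> {y, y'} \<in> uedges \<Delta>"
    by (simp only: image_eq_doubleton_iff[OF inj_Inr])
  show "{Inl x, Inr y} \<in> uedges (graph_join \<Gamma> \<Delta>) \<longleftrightarrow> x \<in> uverts \<Gamma> \<and> y \<in> uverts \<Delta>"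
    using insert_Inl_neq_image_Inr[of x "{Inr y}"] insert_Inr_neq_image_Inl[of y "{Inl x}"]
    by (simp add: graph_join_def doubleton_eq_iff image_iff insert_commute[of "Inl x"])
qed

lemma uverts_X_graph:
  "uverts (X_graph h r) = {1..h - 1} <+> ({1..r} \<times> {1..h div 2} \<times> {1..2})"
  by (simp add: X_graph_def graph_join_def edgeless_graph_def graph_join_family_def
      graph_disjoint_union_def graph_copies_def complete_graph_def)

lemma X_graph_edge_iff:
  "{Inl a, Inl a'} \<notin> uedges (X_graph h r)"
  "{Inl a, Inr p} \<in> uedges (X_graph h r) \<longleftrightarrow> a \<in> {1..h - 1} \<and> p \<in> {1..r} \<times> {1..h div 2} \<times> {1..2}"
  "{Inr (i, j, b), Inr (i, j', b')} \<in> uedges (X_graph h r) \<longleftrightarrow>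
     i \<in> {1..r} \<and> j \<in> {1..h div 2} \<and> j = j' \<and> b \<in> {1..2} \<and> b' \<in> {1..2} \<and> b \<noteq> b'"
  unfolding X_graph_def graph_join_edge_iff graph_join_family_edge_iff graph_copies_def
    graph_disjoint_union_edge_iff complete_graph_edge_iff
  by (auto simp: edgeless_graph_def graph_join_family_def graph_disjoint_union_def complete_graph_def)

section \<open>From a subgroup of index 2 to \<open>X_graph\<close>\<close>

text \<open>Induction that strips off one orbit {a, s a} at a time. The first coordinate numbers the
  orbits, the second tells the two members apart. The number \<open>k\<close> of orbits is left open
  and later found by counting.\<close>

lemma ex_bij_betw_pairs_of_involution:
  assumes "finite A" "\<And>x. x \<in> A \<Longrightarrow> s x \<in> A \<and> s x \<noteq> x \<and> s (s x) = x"
  shows "\<exists>f k. bij_betw f A ({1..k} \<times> {1..2::nat}) \<and> (\<forall>x\<in>A. fst (f (s x)) = (fst (f x) :: nat))"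
  using assms
proof (induction A rule: finite_psubset_induct)
  case (psubset A)
  show ?case
  proof (cases "A = {}")
    case True
    then show ?thesis by (intro exI[of _ undefined] exI[of _ 0]) (simp add: bij_betw_def)
  next
    case False
    then obtain a where a: "a \<in> A" by blast
    let ?B = "A - {a, s a}"
    note s = psubset.prems
    \<comment> \<open>An involution is injective, so s x in the orbit of a would put x there as
      well.\<close>
    have "s x \<in> ?B" if "x \<in> ?B" for x
      using s[of x] s[of a] a that by (metis Diff_iff insert_iff empty_iff)
    moreover have "?B \<subset> A" using a by blast
    ultimately obtain f k where f: "bij_betw f ?B ({1..k} \<times> {1..2::nat})"
        "\<forall>x\<in>?B. fst (f (s x)) = (fst (f x) :: nat)"
      using psubset.IH[of ?B] s by blast
    define g where "g = f(a := (Suc k, 1), s a := (Suc k, 2))"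
    have g_B: "g x = f x" if "x \<in> ?B" for x
      using that by (simp add: g_def)
    have sa: "s a \<in> A" "s a \<noteq> a" "s (s a) = a" using s[OF a] by auto
    have g_a: "g a = (Suc k, 1)" "g (s a) = (Suc k, 2)"
      using sa by (auto simp: g_def)
    have "bij_betw g ?B ({1..k} \<times> {1..2})"
      using f(1) bij_betw_cong[of ?B g f, OF g_B] by simp
    moreover have "bij_betw g {a, s a} ({Suc k} \<times> {1..2})"
      using g_a sa(2) by (auto simp: bij_betw_def inj_on_def numeral_2_eq_2 atLeastAtMostSuc_conv)
    ultimately have "bij_betw g (?B \<union> {a, s a}) ({1..k} \<times> {1..2} \<union> {Suc k} \<times> {1..2})"
      by (rule bij_betw_combine) auto
    moreover have "?B \<union> {a, s a} = A" using a sa by blast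
    moreover have "{1..k} \<times> {1..2} \<union> {Suc k} \<times> {1..2} = {1..Suc k} \<times> {1..2::nat}"
      by (auto simp: atLeastAtMostSuc_conv)
    moreover have "fst (g (s x)) = fst (g x)" if "x \<in> A" for x
    proof (cases "x \<in> ?B")
      case True
      then show ?thesis using f(2) g_B \<open>\<And>x. x \<in> ?B \<Longrightarrow> s x \<in> ?B\<close> by simp
    next
      case False
      then show ?thesis using that g_a sa by auto
    qed
    ultimately show ?thesis by (intro exI[of _ g] exI[of _ "Suc k"]) simp
  qed
qed

text \<open>Elements of \<open>H\<close> have order 1 or 2. Outside \<open>H\<close> the square is a
  nontrivial element of \<open>H\<close>, so the order divides 4 but not 2.\<close>

lemma (in group) prime_ord_iff:
  assumes sq: "\<And>x. x \<in> H \<Longrightarrow> x \<otimes> x = \<one>"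
    and nsq: "\<And>x. x \<in> carrier G - H \<Longrightarrow> x \<otimes> x \<in> H - {\<one>}"
    and z: "z \<in> carrier G"
  shows "Factorial_Ring.prime (ord z) \<longleftrightarrow> z \<in> H - {\<one>}"
proof -
  have two: "z [^] (2::nat) = z \<otimes> z" using z by (simp add: numeral_2_eq_2)
  show ?thesis
  proof (cases "z \<in> H")
    case True
    then have "ord z dvd 2" using z sq two pow_eq_id[of z 2] by simp
    then have "ord z = 1 \<or> ord z = 2" by (meson prime_nat_iff two_is_prime_nat)
    then show ?thesis using True z ord_eq_1[of z] by auto
  next
    case False
    have "z [^] (4::nat) = z [^] (2::nat) \<otimes> z [^] (2::nat)"
      using z by (simp add: nat_pow_mult)
    then have "ord z dvd 2 ^ 2" using nsq[of z] sq False z two pow_eq_id[of z 4] by simp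
    moreover have "\<not> ord z dvd 2" using nsq[of z] False z two pow_eq_id[of z 2] by simp
    \<comment> \<open>A prime dividing 2^2 would already divide 2.\<close>
    ultimately have "\<not> Factorial_Ring.prime (ord z)"
      using prime_dvd_power by blast
    then show ?thesis using False by simp
  qed
qed

text \<open>The criterion applied to both groups. That \<open>H\<close> is a subgroup of index 2 is
  encoded by \<open>par\<close> and \<open>card\<close>: membership in \<open>H\<close> behaves like
  parity under multiplication, and half of the elements are even.\<close>

lemma (in group) POE_compl_graph_iso_X_graph:
  assumes fin: "finite (carrier G)" and H: "H \<subseteq> carrier G" "\<one> \<in> H"
    and card: "card (carrier G) = 2 * card H"
    and par: "\<And>x y. x \<in> carrier G \<Longrightarrow> y \<in> carrier G \<Longrightarrow> x \<otimes> y \<in> H \<longleftrightarrow> (x \<in> H \<longleftrightarrow> y \<in> H)"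
    and sq: "\<And>x. x \<in> H \<Longrightarrow> x \<otimes> x = \<one>"
    and nsq: "\<And>x. x \<in> carrier G - H \<Longrightarrow> x \<otimes> x \<noteq> \<one>"
  shows "ugraph_iso (POE_compl_graph G) (X_graph (card H) 1)"
proof -
  let ?N = "carrier G - H" and ?h = "card H"
  have finH: "finite H" using H(1) fin by (rule finite_subset)
  have cardN: "card ?N = ?h" using card_Diff_subset[OF finH H(1)] card by simp
  \<comment> \<open>The product of x and its inverse is the identity, which lies in
    \<open>H\<close>, so by \<open>par\<close> both factors lie on the same side.\<close>
  have inv: "inv x \<in> ?N \<and> inv x \<noteq> x \<and> inv (inv x) = x" if "x \<in> ?N" for x
  proof -
    have "inv x \<noteq> x" using that nsq[of x] r_inv[of x] by fastforce
    then show ?thesis using that par[of x "inv x"] H(2) by auto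
  qed
  obtain f k where f: "bij_betw f ?N ({1..k} \<times> {1..2::nat})"
      and fst_f: "\<And>x. x \<in> ?N \<Longrightarrow> fst (f (inv x)) = (fst (f x) :: nat)"
    using ex_bij_betw_pairs_of_involution[of ?N "\<lambda>x. inv x"] fin inv by auto
  \<comment> \<open>Counting both sides of the bijection gives 2 * k = card \<open>?N\<close> =
    \<open>?h\<close>.\<close>
  have k: "k = ?h div 2" using bij_betw_same_card[OF f] cardN by simp
  have "card (H - {\<one>}) = card {1..?h - 1}" using H finH by simp
  then obtain g where g: "bij_betw g (H - {\<one>}) {1..?h - 1}"
    using finite_same_card_bij[of "H - {\<one>}" "{1..?h - 1}"] finH by auto
  \<comment> \<open>Nontrivial elements of \<open>H\<close> fill the edgeless part. The other
    elements go to the single constituent of the family, with index 1, where \<open>f\<close> gives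
    the copy of K2 and the end of its edge.\<close>
  define F where "F x = (if x \<in> H then Inl (g x) else Inr (1::nat, f x))" for x
  have "bij_betw F (H - {\<one>}) (Inl ` {1..?h - 1})"
  proof -
    have "bij_betw (Inl \<circ> g) (H - {\<one>}) (Inl ` {1..?h - 1})"
      by (rule bij_betw_trans[OF g]) (auto simp: bij_betw_def)
    then show ?thesis by (rule bij_betw_cong[THEN iffD1, rotated]) (simp add: F_def)
  qed
  moreover have "bij_betw F ?N (Inr ` ({1..1::nat} \<times> {1..k} \<times> {1..2}))"
  proof -
    have "bij_betw ((\<lambda>p. Inr (1::nat, p)) \<circ> f) ?N (Inr ` ({1..1::nat} \<times> {1..k} \<times> {1..2}))"
      by (rule bij_betw_trans[OF f]) (auto simp: bij_betw_def inj_on_def)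
    then show ?thesis by (rule bij_betw_cong[THEN iffD1, rotated]) (simp add: F_def)
  qed
  ultimately have "bij_betw F ((H - {\<one>}) \<union> ?N)
      (Inl ` {1..?h - 1} \<union> Inr ` ({1..1::nat} \<times> {1..k} \<times> {1..2}))"
    by (rule bij_betw_combine) auto
  moreover have "(H - {\<one>}) \<union> ?N = uverts (POE_compl_graph G)"
    using H by (auto simp: POE_compl_graph_def)
  ultimately have bij: "bij_betw F (uverts (POE_compl_graph G)) (uverts (X_graph ?h 1))"
    unfolding uverts_X_graph Plus_def k by simp
  \<comment> \<open>By \<open>par\<close> every square lies in \<open>H\<close>; this strengthens
    \<open>nsq\<close> to the form that \<open>prime_ord_iff\<close> expects.\<close>
  have prime: "Factorial_Ring.prime (ord z) \<longleftrightarrow> z \<in> H - {\<one>}" if "z \<in> carrier G" for z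
    using prime_ord_iff[of H z] sq nsq par that by auto
  \<comment> \<open>The order of xy fails to be prime iff xy is the identity or lies outside
    \<open>H\<close>, and by \<open>par\<close> the latter means that exactly one factor is in
    \<open>H\<close>.\<close>
  have edge: "{x, y} \<in> uedges (POE_compl_graph G) \<longleftrightarrow>
      x \<noteq> y \<and> (x \<otimes> y = \<one> \<or> (x \<in> H \<longleftrightarrow> y \<notin> H))"
    if "x \<in> carrier G - {\<one>}" "y \<in> carrier G - {\<one>}" for x y
    using POE_compl_graph_edge_iff[OF that] prime[of "x \<otimes> y"] par[of x y] that by auto
  have "{x, y} \<in> uedges (POE_compl_graph G) \<longleftrightarrow> {F x, F y} \<in> uedges (X_graph ?h 1)"
    if xy: "x \<in> carrier G - {\<one>}" "y \<in> carrier G - {\<one>}" for x y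
  proof -
    have g_mem: "g z \<in> {1..?h - 1}" if "z \<in> H - {\<one>}" for z
      using bij_betwE[OF g] that by blast
    have f_mem: "f z \<in> {1..?h div 2} \<times> {1..2}" if "z \<in> ?N" for z
      using bij_betwE[OF f] that k by blast
    have cross: "{F u, F v} \<in> uedges (X_graph ?h 1)" if "u \<in> H - {\<one>}" "v \<in> ?N" for u v
      using g_mem[OF that(1)] f_mem[OF that(2)] that by (simp add: F_def X_graph_edge_iff)
    consider "x \<in> H" "y \<in> H" | "x \<in> H" "y \<in> ?N" | "x \<in> ?N" "y \<in> H" | "x \<in> ?N" "y \<in> ?N"
      using xy by blast
    then show ?thesis
    proof cases
      case 1
      \<comment> \<open>Elements of \<open>H\<close> are their own inverses, so distinct ones never
        multiply to the identity.\<close>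
      then have "x \<otimes> y = \<one> \<longrightarrow> x = y"
        using sq[of y] 1 xy by (metis DiffD1 inv_equality)
      then show ?thesis using edge[OF xy] 1 by (auto simp: F_def X_graph_edge_iff)
    next
      case 2
      then show ?thesis using edge[OF xy] cross[of x y] xy by auto
    next
      case 3
      then show ?thesis using edge[OF xy] cross[of y x] xy by (auto simp: insert_commute)
    next
      case 4
      have inj: "f u = f v \<longleftrightarrow> u = v" if "u \<in> ?N" "v \<in> ?N" for u v
        using f that by (auto simp: bij_betw_def inj_on_def)
      have "x \<otimes> y = \<one> \<longleftrightarrow> y = inv x"
        using xy by (metis DiffD1 inv_equality inv_inv r_inv inv_closed)
      also have "\<dots> \<longleftrightarrow> fst (f x) = fst (f y) \<and> snd (f x) \<noteq> snd (f y)"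
      proof
        assume "y = inv x"
        then show "fst (f x) = fst (f y) \<and> snd (f x) \<noteq> snd (f y)"
          using fst_f[of x] inj[of x y] inv[of x] 4 by (metis prod_eqI)
      next
        assume a: "fst (f x) = fst (f y) \<and> snd (f x) \<noteq> snd (f y)"
        \<comment> \<open>Second coordinates take only two values. Both y and the inverse of x lie
          in the copy of x but differ from x in the second coordinate, so they coincide.\<close>
        have "snd (f (inv x)) \<noteq> snd (f x)"
          using fst_f[of x] inj[of x "inv x"] inv[of x] 4 by (metis prod_eqI)
        moreover have "snd (f u) \<in> {1, 2}" if "u \<in> ?N" for u
          using f_mem[OF that] by (cases "f u") auto
        ultimately have "snd (f (inv x)) = snd (f y)"
          using a 4 inv[of x] by (metis insertE singletonD)
        then have "f y = f (inv x)" using a fst_f[of x] 4 by (simp add: prod_eq_iff)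
        then show "y = inv x" using inj inv[of x] 4 by blast
      qed
      finally have "x \<otimes> y = \<one> \<longleftrightarrow> fst (f x) = fst (f y) \<and> snd (f x) \<noteq> snd (f y)" .
      \<comment> \<open>This absorbs the condition that x and y be distinct in
        \<open>edge\<close>.\<close>
      moreover have "x \<otimes> y \<noteq> \<one>" if "x = y" using that nsq 4 by blast
      ultimately show ?thesis
        using edge[OF xy] f_mem[of x] f_mem[of y] 4
        by (cases "f x"; cases "f y") (auto simp: F_def X_graph_edge_iff)
    qed
  qed
  then show ?thesis
    unfolding ugraph_iso_def using bij by (auto simp: POE_compl_graph_def)
qed

section \<open>The Abelian and the non-Abelian group\<close>

lemma carrier_Z2_pow: "carrier (Z2_pow n) = ({1..n} \<rightarrow>\<^sub>E {0..<2})"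
  by (simp add: Z2_pow_def carrier_integer_mod_group)

lemma card_Z2_pow: "card (carrier (Z2_pow n)) = 2 ^ n"
  by (simp add: carrier_Z2_pow card_PiE)

lemma finite_Z2_pow: "finite (carrier (Z2_pow n))"
  by (simp add: carrier_Z2_pow finite_PiE)

lemma mult_Z2_pow: "v \<otimes>\<^bsub>Z2_pow n\<^esub> w = (\<lambda>i\<in>{1..n}. (v i + w i) mod 2)"
  by (simp add: Z2_pow_def)

lemma one_Z2_pow: "\<one>\<^bsub>Z2_pow n\<^esub> = (\<lambda>i\<in>{1..n}. 0)"
  by (simp add: Z2_pow_def)

lemma Z2_pow_square: "v \<otimes>\<^bsub>Z2_pow n\<^esub> v = \<one>\<^bsub>Z2_pow n\<^esub>"
  unfolding mult_Z2_pow one_Z2_pow by (auto simp: fun_eq_iff restrict_def)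

lemma comm_group_Z2_pow: "comm_group (Z2_pow n)"
  by (rule group.group_comm_groupI[OF group_Z2_pow]) (simp add: mult_Z2_pow add.commute)

lemma carrier_Z4: "carrier (integer_mod_group 4) = {0, 1, 2, 3}"
  by (auto simp: carrier_integer_mod_group)

text \<open>An odd element of Z4 doubles to 2 and an even one to 0, while \<open>Z2_pow\<close> has
  exponent dividing 2. Using \<open>n\<close> for m - 1 avoids truncated subtraction.\<close>

lemma Z4_Z2_pow_abelian_realization:
  "abelian_realization (integer_mod_group 4 \<times>\<times> Z2_pow n) (X_graph (2 ^ Suc n) 1)"
proof -
  let ?G = "integer_mod_group 4 \<times>\<times> Z2_pow n"
  let ?H = "{0, 2 :: int} \<times> carrier (Z2_pow n)"
  interpret Z: group "Z2_pow n" by (rule group_Z2_pow)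
  interpret group ?G by (intro DirProd_group group_integer_mod_group group_Z2_pow)
  have comm: "comm_group ?G"
    by (intro group_comm_groupI)
      (auto simp: add.commute comm_groupE(4)[OF comm_group_Z2_pow] comm_group_Z2_pow)
  have carr: "carrier ?G = {0, 1, 2, 3} \<times> carrier (Z2_pow n)"
    by (simp add: DirProd_def carrier_Z4)
  have card: "card ?H = 2 ^ Suc n"
    by (simp add: card_cartesian_product card_Z2_pow)
  have fin: "finite (carrier ?G)"
    using finite_Z2_pow by (simp only: carr) simp
  have "ugraph_iso (POE_compl_graph ?G) (X_graph (card ?H) 1)"
  proof (rule POE_compl_graph_iso_X_graph[OF fin])
    show "card (carrier ?G) = 2 * card ?H"
      unfolding carr by (simp add: card_cartesian_product)
  qed (auto simp: carrier_Z4 Z2_pow_square)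
  then show ?thesis
    using fin is_group comm by (simp add: abelian_realization_def realization_def card)
qed

text \<open>Since \<theta> squares to the identity, even elements of Z4 act trivially, so (v, k)
  with k even squares to the identity. For k odd the square has second component 2, whatever the
  action does.\<close>

lemma G_semi_realization:
  fixes n \<theta>
  defines "A \<equiv> AutoGroup (Z2_pow n)"
  assumes \<theta>: "\<theta> \<in> carrier A" and ord: "group.ord A \<theta> = 2"
  shows "nonabelian_realization (G_semi (Suc n) \<theta>) (X_graph (2 ^ Suc n) 1)"
proof -
  let ?Z = "Z2_pow n"
  let ?H = "carrier ?Z \<times> {0, 2 :: int}"
  interpret Z: group ?Z by (rule group_Z2_pow)
  interpret A: group A unfolding A_def by (rule Z.AutoGroup)
  interpret group "G_semi (Suc n) \<theta>"
    using group_G_semi[of \<theta> "Suc n"] \<theta> ord unfolding A_def by simp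
  have carr: "carrier (G_semi (Suc n) \<theta>) = carrier ?Z \<times> {0, 1, 2, 3}"
    by (simp add: G_semi_def semidirect_product_def carrier_Z4)
  have mult: "(v, k) \<otimes>\<^bsub>G_semi (Suc n) \<theta>\<^esub> (w, l) = (v \<otimes>\<^bsub>?Z\<^esub> (\<theta> [^]\<^bsub>A\<^esub> k) w, (k + l) mod 4)"
    for v w and k l :: int
    by (simp add: G_semi_def semidirect_product_def A_def)
  have one: "\<one>\<^bsub>G_semi (Suc n) \<theta>\<^esub> = (\<one>\<^bsub>?Z\<^esub>, 0)"
    by (simp add: G_semi_def semidirect_product_def)
  have A_closed: "a v \<in> carrier ?Z" if "a \<in> carrier A" "v \<in> carrier ?Z" for a v
    using that by (auto simp: A_def AutoGroup_def auto_def hom_def)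
  have A_one: "\<one>\<^bsub>A\<^esub> v = v" if "v \<in> carrier ?Z" for v
    using that by (simp add: A_def AutoGroup_def BijGroup_def)
  have pow2: "\<theta> [^]\<^bsub>A\<^esub> (2::int) = \<one>\<^bsub>A\<^esub>"
    using A.pow_ord_eq_1[OF \<theta>] ord int_pow_int[of A \<theta> 2] by simp
  have pow: "(\<theta> [^]\<^bsub>A\<^esub> (k::int)) v \<in> carrier ?Z" if "v \<in> carrier ?Z" for k v
    using A_closed[OF A.int_pow_closed[OF \<theta>] that] .
  have card: "card ?H = 2 ^ Suc n"
    by (simp add: card_cartesian_product card_Z2_pow)
  have fin: "finite (carrier (G_semi (Suc n) \<theta>))"
    by (simp add: carr finite_Z2_pow)
  have "ugraph_iso (POE_compl_graph (G_semi (Suc n) \<theta>)) (X_graph (card ?H) 1)"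
  proof (rule POE_compl_graph_iso_X_graph[OF fin])
    show "card (carrier (G_semi (Suc n) \<theta>)) = 2 * card ?H"
      by (simp add: carr card_cartesian_product)
    show "x \<otimes>\<^bsub>G_semi (Suc n) \<theta>\<^esub> x = \<one>\<^bsub>G_semi (Suc n) \<theta>\<^esub>" if "x \<in> ?H" for x
      using that A_one pow2 by (auto simp: mult one Z2_pow_square)
  qed (auto simp: carr mult one pow pow2 A_one)
  moreover have "\<not> comm_group (G_semi (Suc n) \<theta>)"
  proof
    assume "comm_group (G_semi (Suc n) \<theta>)"
    have "\<theta> v = v" if v: "v \<in> carrier ?Z" for v
    proof -
      \<comment> \<open>The two products are (\<theta> v, 1) and (v, 1), so commutativity would make
        \<theta> fix every v.\<close>
      have "(\<one>\<^bsub>?Z\<^esub>, 1) \<otimes>\<^bsub>G_semi (Suc n) \<theta>\<^esub> (v, 0) = (v, 0) \<otimes>\<^bsub>G_semi (Suc n) \<theta>\<^esub> (\<one>\<^bsub>?Z\<^esub>, 1)"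
        using comm_groupE(4)[OF \<open>comm_group (G_semi (Suc n) \<theta>)\<close>] v by (simp add: carr)
      then show ?thesis
        using v A_closed[OF \<theta> v] \<theta> A_one[OF Z.one_closed] A_one[OF v] by (simp add: mult)
    qed
    \<comment> \<open>Extensionality turns agreement with the identity on the carrier into equality
      of functions.\<close>
    moreover have "\<theta> \<in> extensional (carrier ?Z)"
      using \<theta> by (auto simp: A_def AutoGroup_def auto_def Bij_def)
    ultimately have "\<theta> = \<one>\<^bsub>A\<^esub>"
      by (auto simp: A_def AutoGroup_def BijGroup_def fun_eq_iff restrict_def extensional_def)
    then show False using ord by simp
  qed
  ultimately show ?thesis
    using fin is_group by (simp add: nonabelian_realization_def realization_def card)
qed

section \<open>Existence of a suitable automorphism, and the conclusion\<close>

text \<open>The witness swaps the first two coordinates, which is possible because n is at least 2.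
  In the theorem this corresponds to m being at least 3.\<close>

lemma ex_Z2_pow_automorphism_ord_2:
  assumes "n \<ge> 2"
  shows "\<exists>\<theta> \<in> carrier (AutoGroup (Z2_pow n)). group.ord (AutoGroup (Z2_pow n)) \<theta> = 2"
proof -
  let ?Z = "Z2_pow n" and ?A = "AutoGroup (Z2_pow n)"
  interpret Z: group ?Z by (rule group_Z2_pow)
  interpret A: group ?A by (rule Z.AutoGroup)
  define t where "t = (\<lambda>v :: nat \<Rightarrow> int. v \<circ> Transposition.transpose 1 2)"
  \<comment> \<open>Restriction makes the swap extensional, as members of \<open>AutoGroup\<close>
    must be.\<close>
  define \<theta> where "\<theta> = restrict t (carrier ?Z)"
  have tr: "Transposition.transpose 1 2 i \<in> {1..n} \<longleftrightarrow> i \<in> {1..n}" for i :: nat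
    using assms by (auto simp: transpose_def)
  have closed: "t v \<in> carrier ?Z" if "v \<in> carrier ?Z" for v
    using that tr unfolding carrier_Z2_pow PiE_def Pi_def extensional_def t_def by auto
  have tt: "t (t v) = v" for v
    by (simp add: t_def fun_eq_iff)
  have "bij_betw \<theta> (carrier ?Z) (carrier ?Z)"
    by (rule bij_betw_byWitness[where f' = t]) (auto simp: \<theta>_def closed tt)
  moreover have "t (v \<otimes>\<^bsub>?Z\<^esub> w) = t v \<otimes>\<^bsub>?Z\<^esub> t w" for v w
    using tr by (auto simp: mult_Z2_pow t_def fun_eq_iff restrict_def)
  then have "\<theta> \<in> hom ?Z ?Z"
    using closed by (auto simp: hom_def \<theta>_def)
  ultimately have \<theta>: "\<theta> \<in> carrier ?A"
    by (simp add: AutoGroup_def auto_def Bij_def \<theta>_def)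
  then have Bij: "\<theta> \<in> Bij (carrier ?Z)"
    by (simp add: AutoGroup_def auto_def)
  have "\<theta> \<otimes>\<^bsub>?A\<^esub> \<theta> = \<one>\<^bsub>?A\<^esub>"
    using Bij by (auto simp: AutoGroup_def BijGroup_def compose_def \<theta>_def closed tt fun_eq_iff)
  then have "A.ord \<theta> dvd 2"
    using A.pow_eq_id[OF \<theta>, of 2] \<theta> by (simp add: numeral_2_eq_2)
  moreover have "\<theta> \<noteq> \<one>\<^bsub>?A\<^esub>"
  proof
    \<comment> \<open>The first unit vector is moved by the swap, so \<theta> is not the
      identity.\<close>
    let ?v = "\<lambda>i\<in>{1..n}. if i = 1 then 1 else 0 :: int"
    assume "\<theta> = \<one>\<^bsub>?A\<^esub>"
    moreover have v: "?v \<in> carrier ?Z" by (auto simp: carrier_Z2_pow)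
    ultimately have "t ?v = ?v"
      by (metis (no_types, lifting) AutoGroup_def BijGroup_def \<theta>_def monoid.select_convs(2)
          monoid.simps(2) partial_object.update_convs(1) restrict_apply')
    then have "t ?v 1 = ?v 1" by metis
    then show False using assms by (simp add: t_def)
  qed
  then have "A.ord \<theta> \<noteq> 1" using A.ord_eq_1[OF \<theta>] by simp
  ultimately have "A.ord \<theta> = 2" by (meson prime_nat_iff two_is_prime_nat)
  then show ?thesis using \<theta> by blast
qed

theorem mainTheorem6:
  fixes m :: nat
  assumes "m \<ge> 3"
  shows "admits_abelian_realization (X_graph (2 ^ m) 1) \<and>
    admits_nonabelian_realization (X_graph (2 ^ m) 1) \<and>
    (\<forall>\<theta> \<in> carrier (AutoGroup (Z2_pow (m - 1))).
       \<theta> \<noteq> \<one>\<^bsub>AutoGroup (Z2_pow (m - 1))\<^esub> \<longrightarrow>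
       group.ord (AutoGroup (Z2_pow (m - 1))) \<theta> = 2 \<longrightarrow>
       ugraph_iso (POE_compl_graph (integer_mod_group 4 \<times>\<times> Z2_pow (m - 1)))
                  (POE_compl_graph (G_semi m \<theta>)) \<and>
       ugraph_iso (POE_compl_graph (G_semi m \<theta>)) (X_graph (2 ^ m) 1))"
proof -
  have abelian: "abelian_realization (integer_mod_group 4 \<times>\<times> Z2_pow (m - 1)) (X_graph (2 ^ m) 1)"
    using Z4_Z2_pow_abelian_realization[of "m - 1"] assms by simp
  have nonabelian: "nonabelian_realization (G_semi m \<theta>) (X_graph (2 ^ m) 1)"
    if "\<theta> \<in> carrier (AutoGroup (Z2_pow (m - 1)))"
      "group.ord (AutoGroup (Z2_pow (m - 1))) \<theta> = 2" for \<theta>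
    using G_semi_realization[of \<theta> "m - 1"] that assms by simp
  \<comment> \<open>A concrete \<theta> yields the non-Abelian realization; it also shows that the
    quantified claim is not vacuous.\<close>
  obtain \<theta> where "\<theta> \<in> carrier (AutoGroup (Z2_pow (m - 1)))"
      "group.ord (AutoGroup (Z2_pow (m - 1))) \<theta> = 2"
    using ex_Z2_pow_automorphism_ord_2[of "m - 1"] assms by fastforce
  then have "admits_nonabelian_realization (X_graph (2 ^ m) 1)"
    using nonabelian by (blast intro: admits_nonabelian_realizationI)
  then show ?thesis
    using admits_abelian_realizationI[OF abelian] abelian nonabelian
    unfolding abelian_realization_def nonabelian_realization_def realization_def
    \<comment> \<open>The isomorphism between the two group graphs passes through
      \<open>X_graph\<close>.\<close>
    by (blast intro: ugraph_iso_trans ugraph_iso_sym)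
qed

end
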